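(* Let $M,\kappa\ge 1$ be integers, $\varepsilon\in(0,1)$, $\delta>0$, $\eta>0$, $p_t,p_r,p_{syn}>0$, $r_{\min}\ge 0$ and $0<p_{\min}\le p_{\max}$. Fix one of the schemes SC, SSC, MRC, with its $\beta\in\{0,1\}$ and $\omega>0$ as in the context, and write $P=p_t+M^{\beta}p_r+p_{syn}$ and $p_{\mathrm{low}}=\max\big(p_{\min},\frac{2^{r_{\min}}-1}{\omega}\big)$. Assume $p_{\mathrm{low}}\le p_{\max}$. Set $$\rho=\frac{1}{\omega}\left(\frac{\omega\eta P-1}{\mathcal{W}\big(\frac{\omega\eta P-1}{e}\big)}-1\right),\qquad \varrho=\frac{1}{\ln 2}\Big(\mathcal{W}\Big(\frac{\omega\eta P-1}{e}\Big)+1\Big).$$ Consider the problem of maximizing the energy efficiency $$\frac{(1-\varepsilon)\log_2(1+\omega p_0)}{p_0/\eta+P}\quad\text{over } p_0\in[p_{\mathrm{low}},p_{\max}],$$ with allocated rate $r_0=\log_2(1+\omega p_0)$. Then the optimum resource allocation $(p_0^*,r_0^* )$ is given by: (i) if $\rho<p_{\mathrm{low}}$, then $p_0^*=\max\big(p_{\min},\frac{2^{r_{\min}}-1}{\omega}\big)$ and $r_0^*=\max\big(\log_2(\omega p_{\min}+1),\,r_{\min}\big)$; (ii) if $p_{\mathrm{low}}\le\rho\le p_{\max}$, then $p_0^*=\rho$ and $r_0^*=\varrho$; (iii) if $\rho>p_{\max}$, then $p_0^*=p_{\max}$ and $r_0^*=\log_2(\omega p_{\max}+1)$.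
   Context: $\mathcal{W}$ is the main branch of the Lambert W function, i.e. for $x\ge -1/e$, $\mathcal{W}(x)\ge -1$ is the solution $w\geq -1$ of $we^w=x$. When $\omega\eta P=1$ the quotient $\frac{\omega\eta P-1}{\mathcal{W}((\omega\eta P-1)/e)}$ is read as its limiting value $e$ (in general it equals $e^{1+\mathcal{W}((\omega\eta P-1)/e)}$). Scheme parameters: $\beta=0$ for SSC (switch and stay combining), $\beta=1$ for SC (selection combining) and for MRC (maximum ratio combining). Further, $$\omega=\kappa\delta\big((1-\varepsilon^{1/M})^{-1/\kappa}-1\big)\ \text{ for SC and SSC},\qquad \omega=\delta\,(M!)^{1/M}\,\big|\ln(1-\varepsilon^{1/M})\big|\ \text{ for MRC}.$$ Setting: $p_0$ and $r_0$ are the transmit power and rate of a link received with $M$ antennas in the presence of $\kappa$ interferers; $\varepsilon$ is the target outage probability; along the curve $r_0=\log_2(1+\omega p_0)$ the outage probability is taken equal to $\varepsilon$. The constraints are $r_0\ge r_{\min}$ and $p_{\min}\le p_0\le p_{\max}$, which along this curve amount to $p_{\mathrm{low}}\le p_0\le p_{\max}$. The energy efficiency is throughput divided by consumed power $p_0/\eta+p_t+M^{\beta}p_r+p_{syn}$, where $\eta$ is the amplifier drain efficiency and $p_t,p_r,p_{syn}$ are circuit powers. *)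

theory Defs
  imports "HOL-Analysis.Analysis"
begin

text \<open>Main branch of the Lambert W function. The value is meaningful for
  \<open>x \<ge> - 1 / exp 1\<close> only; lemma \<open>lambert_W_unique_solution\<close> below shows that
  the description is proper there.\<close>

definition lambert_W :: "real \<Rightarrow> real" where
  "lambert_W x = (THE w. - 1 \<le> w \<and> w * exp w = x)"

lemma lambert_W_unique_solution:
  fixes x :: real
  assumes "- 1 / exp 1 \<le> x"
  shows "\<exists>!w. - 1 \<le> w \<and> w * exp w = x"
proof -
  define f where "f = (\<lambda>w::real. w * exp w)"
  have less: "f a < f b" if "- 1 \<le> a" "a < b" for a b
  proof (rule DERIV_pos_imp_increasing_open[OF that(2)])
    fix y assume y: "a < y" "y < b"
    have "(f has_real_derivative (1 + y) * exp y) (at y)"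
      unfolding f_def by (auto intro!: derivative_eq_intros simp: algebra_simps)
    moreover have "(1 + y) * exp y > 0" using y that(1) by simp
    ultimately show "\<exists>d. (f has_real_derivative d) (at y) \<and> 0 < d" by blast
  qed (auto simp: f_def intro!: continuous_intros)
  have "f (- 1) = - 1 / exp 1" by (simp add: f_def exp_minus field_simps)
  then have lo: "f (- 1) \<le> x" using assms by simp
  have "\<bar>x\<bar> * 1 \<le> \<bar>x\<bar> * exp \<bar>x\<bar>" by (intro mult_left_mono) auto
  then have hi: "x \<le> f \<bar>x\<bar>" by (simp add: f_def)
  have "continuous_on {- 1..\<bar>x\<bar>} f" unfolding f_def by (intro continuous_intros)
  then obtain w where "- 1 \<le> w" "f w = x"
    using IVT'[of f "- 1" x "\<bar>x\<bar>", OF lo hi] by force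
  moreover have "a = b" if "- 1 \<le> a" "- 1 \<le> b" "f a = f b" for a b
    using less[of a b] less[of b a] that by (cases a b rule: linorder_cases) auto
  ultimately show ?thesis unfolding f_def by metis
qed

text \<open>The quotient \<open>y / lambert_W (y / exp 1)\<close>, extended to \<open>y = 0\<close> (where it is
  \<open>0 / 0\<close>) by its limit \<open>exp 1\<close>.\<close>

definition lambert_quotient :: "real \<Rightarrow> real" where
  "lambert_quotient y = (if y = 0 then exp 1 else y / lambert_W (y / exp 1))"

text \<open>Switch and stay combining, selection combining, maximum ratio combining.\<close>

datatype combining_scheme = SSC | SC | MRC

fun scheme_beta :: "combining_scheme \<Rightarrow> nat" where
  "scheme_beta SSC = 0"
| "scheme_beta SC = 1"
| "scheme_beta MRC = 1"

fun scheme_omega :: "combining_scheme \<Rightarrow> nat \<Rightarrow> nat \<Rightarrow> real \<Rightarrow> real \<Rightarrow> real" where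
  "scheme_omega MRC M \<kappa> \<epsilon> \<delta> =
     \<delta> * (fact M powr (1 / real M)) * \<bar>ln (1 - \<epsilon> powr (1 / real M))\<bar>"
| "scheme_omega _ M \<kappa> \<epsilon> \<delta> =
     real \<kappa> * \<delta> * ((1 - \<epsilon> powr (1 / real M)) powr (- 1 / real \<kappa>) - 1)"

text \<open>Throughput over consumed power along the curve \<open>r = log 2 (1 + \<omega> * p)\<close>, on which
  the outage probability equals \<open>\<epsilon>\<close>; \<open>P\<close> is the total circuit power.\<close>

definition energy_efficiency :: "real \<Rightarrow> real \<Rightarrow> real \<Rightarrow> real \<Rightarrow> real \<Rightarrow> real" where
  "energy_efficiency \<epsilon> \<omega> \<eta> P p = (1 - \<epsilon>) * log 2 (1 + \<omega> * p) / (p / \<eta> + P)"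

definition optimal_allocation ::
    "real \<Rightarrow> real \<Rightarrow> real \<Rightarrow> real \<Rightarrow> real \<Rightarrow> real \<Rightarrow> real \<Rightarrow> real \<Rightarrow> bool" where
  "optimal_allocation \<epsilon> \<omega> \<eta> P plow pmax p r \<longleftrightarrow>
     is_arg_max (energy_efficiency \<epsilon> \<omega> \<eta> P) (\<lambda>q. q \<in> {plow..pmax}) p \<and>
     r = log 2 (1 + \<omega> * p)"

end

theory Submission
  imports Defs
begin

text \<open>In the variable \<open>x = 1 + \<omega> * p\<close> the energy efficiency is a positive multiple of
  \<open>ln x / (x + y)\<close> with \<open>y = \<omega> * \<eta> * P - 1 > - 1\<close>. Its derivative has the sign of
  \<open>1 + y / x - ln x\<close>, which is strictly decreasing for \<open>x \<ge> 1\<close> and vanishes at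
  \<open>x = exp (1 + w)\<close> where \<open>w = lambert_W (y / exp 1)\<close>. The objective therefore increases up to
  \<open>\<rho>\<close> and decreases afterwards, and its unique maximizer on an interval is the point of the
  interval closest to \<open>\<rho>\<close>.\<close>

lemma lambert_W_eqn:
  assumes "- 1 / exp 1 \<le> x"
  shows "- 1 \<le> lambert_W x" "lambert_W x * exp (lambert_W x) = x"
  using theI'[OF lambert_W_unique_solution[OF assms]] by (auto simp: lambert_W_def)

text \<open>Multiplying the defining equation of the Lambert function at \<open>y / exp 1\<close> by
  \<open>exp 1\<close> yields \<open>w * exp (1 + w) = y\<close>. Since \<open>w = - 1\<close> would
  force \<open>y = - 1\<close>, the bound on \<open>w\<close> is strict. The value
  \<open>exp 1\<close> prescribed at \<open>y = 0\<close> is the case \<open>w = 0\<close>.\<close>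

lemma
  assumes "- 1 < y"
  shows lambert_W_gt_minus_one: "- 1 < lambert_W (y / exp 1)"
    and lambert_W_mult_exp: "lambert_W (y / exp 1) * exp (1 + lambert_W (y / exp 1)) = y"
    and lambert_quotient_eq_exp: "lambert_quotient y = exp (1 + lambert_W (y / exp 1))"
proof -
  define w where "w = lambert_W (y / exp 1)"
  have "- 1 / exp 1 \<le> y / exp 1"
    using assms by (intro divide_right_mono) auto
  then have w: "- 1 \<le> w" "w * exp w = y / exp 1"
    unfolding w_def by (rule lambert_W_eqn)+
  then have y: "w * exp (1 + w) = y"
    by (simp add: exp_add field_simps)
  then show "lambert_W (y / exp 1) * exp (1 + lambert_W (y / exp 1)) = y"
    by (simp add: w_def)
  have "w \<noteq> - 1"
    using y assms by auto
  then show "- 1 < lambert_W (y / exp 1)"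
    using w by (simp add: w_def)
  show "lambert_quotient y = exp (1 + lambert_W (y / exp 1))"
    unfolding lambert_quotient_def w_def[symmetric] using y by (auto simp: field_simps)
qed

lemma ln_over_affine_unimodal:
  fixes w y :: real
  assumes "- 1 < y" and "- 1 < w" and y: "w * exp (1 + w) = y"
  shows "strict_mono_on {1..exp (1 + w)} (\<lambda>x. ln x / (x + y))"
    and "strict_antimono_on {exp (1 + w)..} (\<lambda>x. ln x / (x + y))"
proof -
  define g where "g = (\<lambda>x. ln x / (x + y))"
  define h where "h = (\<lambda>x. 1 + y / x - ln x)"
  \<comment> \<open>At this point \<open>y / x = w\<close> and \<open>ln x = 1 + w\<close>, so the
    terms of \<open>h\<close> cancel.\<close>
  have h0: "h (exp (1 + w)) = 0"
    by (simp add: h_def y[symmetric])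
  have one: "1 < exp (1 + w)"
    using assms by simp
  have h_less: "h b < h a" if "1 \<le> a" "a < b" for a b
  proof (rule DERIV_neg_imp_decreasing[OF that(2)])
    fix x assume "a \<le> x" "x \<le> b"
    then have x: "1 \<le> x"
      using that by simp
    have "(h has_real_derivative - (x + y) / x\<^sup>2) (at x)"
      unfolding h_def using x
      by (auto intro!: derivative_eq_intros simp: field_simps power2_eq_square)
    moreover have "- (x + y) / x\<^sup>2 < 0"
      using x assms(1) by (intro divide_neg_pos) auto
    ultimately show "\<exists>d. (h has_real_derivative d) (at x) \<and> d < 0"
      by blast
  qed
  \<comment> \<open>Quotient rule: the numerator \<open>(x + y) / x - ln x\<close> is
    \<open>h x\<close>, and \<open>x + y\<close> is positive because \<open>- 1 < y\<close> and
    \<open>1 \<le> x\<close>.\<close>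
  have g_deriv: "(g has_real_derivative h x / (x + y)\<^sup>2) (at x)" if "1 \<le> x" for x
    unfolding g_def h_def using that assms(1)
    by (auto intro!: derivative_eq_intros simp: field_simps power2_eq_square)
  have g_cont: "continuous_on {a..b} g" if "1 \<le> a" for a b
    using that
    by (intro continuous_at_imp_continuous_on ballI DERIV_isCont[OF g_deriv]) auto
  have sq: "0 < (x + y)\<^sup>2" if "1 \<le> x" for x
    using that assms(1) by simp
  show "strict_mono_on {1..exp (1 + w)} (\<lambda>x. ln x / (x + y))"
    unfolding g_def[symmetric]
  proof (rule strict_mono_onI)
    fix a b assume ab: "a \<in> {1..exp (1 + w)}" "b \<in> {1..exp (1 + w)}" "a < b"
    show "g a < g b"
    \<comment> \<open>The open version is needed: \<open>b\<close> may be
      \<open>exp (1 + w)\<close>, where the derivative vanishes.\<close>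
    proof (rule DERIV_pos_imp_increasing_open[OF ab(3)])
      fix x assume x: "a < x" "x < b"
      then have "0 < h x"
        using h_less[of x "exp (1 + w)"] h0 ab by simp
      then show "\<exists>d. (g has_real_derivative d) (at x) \<and> 0 < d"
        using g_deriv[of x] sq[of x] x ab by (intro exI[of _ "h x / (x + y)\<^sup>2"]) auto
    qed (use ab g_cont in auto)
  qed
  show "strict_antimono_on {exp (1 + w)..} (\<lambda>x. ln x / (x + y))"
    unfolding g_def[symmetric]
  proof (rule monotone_onI)
    fix a b assume ab: "a \<in> {exp (1 + w)..}" "b \<in> {exp (1 + w)..}" "a < b"
    then have a1: "1 \<le> a"
      using one by (simp del: one_less_exp_iff)
    show "g b < g a"
    proof (rule DERIV_neg_imp_decreasing_open[OF ab(3)])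
      fix x assume x: "a < x" "x < b"
      then have x1: "1 \<le> x"
        using a1 by simp
      have "h x < 0"
        using h_less[of "exp (1 + w)" x] h0 ab x one by simp
      then show "\<exists>d. (g has_real_derivative d) (at x) \<and> d < 0"
        using g_deriv[OF x1] sq[OF x1]
        by (intro exI[of _ "h x / (x + y)\<^sup>2"]) (auto intro: divide_neg_pos)
    qed (use g_cont[OF a1] in auto)
  qed
qed

lemma energy_efficiency_unimodal:
  assumes "\<epsilon> < 1" "0 < \<omega>" "0 < \<eta>" "0 < P"
    and m: "m = 1 / \<omega> * (lambert_quotient (\<omega> * \<eta> * P - 1) - 1)"
  shows "strict_mono_on {0..m} (energy_efficiency \<epsilon> \<omega> \<eta> P)"
    and "strict_antimono_on {m..} (energy_efficiency \<epsilon> \<omega> \<eta> P)"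
    and "0 < m"
proof -
  define y where "y = \<omega> * \<eta> * P - 1"
  define w where "w = lambert_W (y / exp 1)"
  define g where "g = (\<lambda>x. ln x / (x + y))"
  \<comment> \<open>The consumed power \<open>p / \<eta> + P\<close> equals
    \<open>(x + y) / (\<omega> * \<eta>)\<close> for \<open>x = 1 + \<omega> * p\<close>; together
    with \<open>log 2 x = ln x / ln 2\<close> this leaves the factor \<open>c\<close>.\<close>
  define c where "c = (1 - \<epsilon>) * \<omega> * \<eta> / ln 2"
  have y: "- 1 < y"
    using assms by (simp add: y_def)
  note unimodal = ln_over_affine_unimodal[OF y lambert_W_gt_minus_one[OF y]
    lambert_W_mult_exp[OF y], folded w_def g_def]
  have xm: "exp (1 + w) = 1 + \<omega> * m"
    using assms lambert_quotient_eq_exp[OF y] by (simp add: w_def y_def)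
  have "1 < exp (1 + w)"
    using lambert_W_gt_minus_one[OF y] by (simp add: w_def)
  then show m0: "0 < m"
    using xm assms by (simp add: zero_less_mult_iff)
  have c: "0 < c"
    using assms by (simp add: c_def)
  have ee: "energy_efficiency \<epsilon> \<omega> \<eta> P p = c * g (1 + \<omega> * p)" if "0 \<le> p" for p
  proof -
    have "1 + \<omega> * p + y = \<omega> * \<eta> * (p / \<eta> + P)"
      using assms by (simp add: y_def field_simps)
    then show ?thesis
      using assms by (simp add: energy_efficiency_def g_def c_def log_def)
  qed
  show "strict_mono_on {0..m} (energy_efficiency \<epsilon> \<omega> \<eta> P)"
  proof (rule strict_mono_onI)
    fix a b assume "a \<in> {0..m}" "b \<in> {0..m}" "a < b"
    then show "energy_efficiency \<epsilon> \<omega> \<eta> P a < energy_efficiency \<epsilon> \<omega> \<eta> P b"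
      using strict_mono_onD[OF unimodal(1), of "1 + \<omega> * a" "1 + \<omega> * b"] \<open>0 < \<omega>\<close> c xm by (simp add: ee)
  qed
  show "strict_antimono_on {m..} (energy_efficiency \<epsilon> \<omega> \<eta> P)"
  proof (rule monotone_onI)
    fix a b assume "a \<in> {m..}" "b \<in> {m..}" "a < b"
    then show "energy_efficiency \<epsilon> \<omega> \<eta> P b < energy_efficiency \<epsilon> \<omega> \<eta> P a"
      using monotone_onD[OF unimodal(2), of "1 + \<omega> * a" "1 + \<omega> * b"] \<open>0 < \<omega>\<close> c xm m0 by (simp add: ee)
  qed
qed

text \<open>Clamping the peak \<open>m\<close> to the interval covers all three cases of the
  allocation at once. Strict monotonicity on both sides makes every other point strictly worse,
  which gives uniqueness as well as optimality.\<close>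

lemma is_arg_max_unimodal:
  fixes f :: "'a::linorder \<Rightarrow> 'b::order"
  assumes inc: "strict_mono_on {a..m} f" and dec: "strict_antimono_on {m..} f"
    and "a \<le> lo" "lo \<le> hi"
  shows "is_arg_max f (\<lambda>q. q \<in> {lo..hi}) p \<longleftrightarrow> p = max lo (min m hi)"
proof -
  define c where "c = max lo (min m hi)"
  have c: "c \<in> {lo..hi}"
    using assms by (auto simp: c_def)
  have less: "f q < f c" if q: "q \<in> {lo..hi}" "q \<noteq> c" for q
  proof (cases q c rule: linorder_cases)
    case less
    \<comment> \<open>From \<open>lo \<le> q < c\<close> the outer maximum is not \<open>lo\<close>,
      so \<open>c = min m hi\<close>.\<close>
    then have "c \<le> m"
      using q by (auto simp: c_def max_def min_def split: if_splits)
    moreover have "a \<le> q"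
      using q assms(3) by auto
    ultimately show ?thesis
      using strict_mono_onD[OF inc, of q c] less by auto
  next
    case greater
    \<comment> \<open>From \<open>c < q \<le> hi\<close> the inner minimum is not \<open>hi\<close>,
      so \<open>c = max lo m\<close>.\<close>
    then have "m \<le> c"
      using q by (auto simp: c_def max_def min_def split: if_splits)
    then show ?thesis
      using monotone_onD[OF dec, of c q] greater by auto
  qed (use q in simp)
  show ?thesis
    unfolding c_def[symmetric] is_arg_max_def using c less by (metis less_asym less_irrefl)
qed

text \<open>The number \<open>1 - \<epsilon> powr (1 / real M)\<close> lies strictly between 0 and
  1, so its negative powers exceed 1 (SC and SSC) and its logarithm is nonzero (MRC).\<close>

lemma scheme_omega_pos:
  assumes "M \<ge> 1" "\<kappa> \<ge> 1" "0 < \<epsilon>" "\<epsilon> < 1" "\<delta> > 0"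
  shows "0 < scheme_omega scheme M \<kappa> \<epsilon> \<delta>"
proof -
  define a where "a = 1 - \<epsilon> powr (1 / real M)"
  have a: "0 < a" "a < 1"
    using assms powr_less_mono2[of "1 / real M" \<epsilon> 1] by (auto simp: a_def)
  have "1 < a powr (- 1 / real \<kappa>)"
    using powr_less_mono2_neg[of "- 1 / real \<kappa>" a 1] a assms by simp
  moreover have "ln a \<noteq> 0"
    using a ln_less_zero[of a] by simp
  ultimately show ?thesis
    using assms by (cases scheme) (simp_all add: a_def)
qed

theorem theorem3:
  fixes M \<kappa> :: nat and scheme :: combining_scheme
    and \<epsilon> \<delta> \<eta> pt pr psyn rmin pmin pmax \<omega> P plow \<rho> \<rho>' :: real
  assumes "M \<ge> 1" and "\<kappa> \<ge> 1"
    and "0 < \<epsilon>" and "\<epsilon> < 1" and "\<delta> > 0" and "\<eta> > 0"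
    and "pt > 0" and "pr > 0" and "psyn > 0"
    and "rmin \<ge> 0" and "0 < pmin" and "pmin \<le> pmax"
    and omega: "\<omega> = scheme_omega scheme M \<kappa> \<epsilon> \<delta>"
    and P: "P = pt + real M ^ scheme_beta scheme * pr + psyn"
    and plow: "plow = max pmin ((2 powr rmin - 1) / \<omega>)"
    and "plow \<le> pmax"
    and rho: "\<rho> = 1 / \<omega> * (lambert_quotient (\<omega> * \<eta> * P - 1) - 1)"
    and varrho: "\<rho>' = 1 / ln 2 * (lambert_W ((\<omega> * \<eta> * P - 1) / exp 1) + 1)"
  shows "(\<rho> < plow \<longrightarrow>
           (\<forall>p r. optimal_allocation \<epsilon> \<omega> \<eta> P plow pmax p r \<longleftrightarrow>
             p = max pmin ((2 powr rmin - 1) / \<omega>) \<and>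
             r = max (log 2 (\<omega> * pmin + 1)) rmin)) \<and>
         (plow \<le> \<rho> \<and> \<rho> \<le> pmax \<longrightarrow>
           (\<forall>p r. optimal_allocation \<epsilon> \<omega> \<eta> P plow pmax p r \<longleftrightarrow>
             p = \<rho> \<and> r = \<rho>')) \<and>
         (\<rho> > pmax \<longrightarrow>
           (\<forall>p r. optimal_allocation \<epsilon> \<omega> \<eta> P plow pmax p r \<longleftrightarrow>
             p = pmax \<and> r = log 2 (\<omega> * pmax + 1)))"
proof -
  have \<omega>: "0 < \<omega>"
    unfolding omega using assms by (intro scheme_omega_pos)
  have "0 < P"
    unfolding P using assms by (simp add: add_pos_nonneg)
  note unimodal = energy_efficiency_unimodal[OF \<open>\<epsilon> < 1\<close> \<omega> \<open>0 < \<eta>\<close> this rho]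
  have "0 \<le> plow"
    using plow \<open>0 < pmin\<close> by simp
  \<comment> \<open>The cases (i), (ii), (iii) are the three values \<open>plow\<close>,
    \<open>\<rho>\<close>, \<open>pmax\<close> that this clamp can take.\<close>
  then have opt: "optimal_allocation \<epsilon> \<omega> \<eta> P plow pmax p r \<longleftrightarrow>
      p = max plow (min \<rho> pmax) \<and> r = log 2 (1 + \<omega> * p)" for p r
    unfolding optimal_allocation_def
    using is_arg_max_unimodal[OF unimodal(1,2) _ \<open>plow \<le> pmax\<close>] by simp
  have r_low: "log 2 (1 + \<omega> * plow) = max (log 2 (\<omega> * pmin + 1)) rmin"
  proof -
    \<comment> \<open>The map \<open>p \<mapsto> 1 + \<omega> * p\<close> is increasing and sends
      \<open>(2 powr rmin - 1) / \<omega>\<close> to \<open>2 powr rmin\<close>, whose binary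
      logarithm is \<open>rmin\<close>.\<close>
    have "1 + \<omega> * plow = max (\<omega> * pmin + 1) (2 powr rmin)"
      using \<omega> by (auto simp: plow max_def field_simps)
    moreover have "log 2 (\<omega> * pmin + 1) \<le> rmin \<longleftrightarrow> \<omega> * pmin + 1 \<le> 2 powr rmin"
      using \<omega> \<open>0 < pmin\<close> by (intro log_le_iff) (auto intro: add_pos_pos)
    ultimately show ?thesis
      by (simp add: max_def)
  qed
  have y: "- 1 < \<omega> * \<eta> * P - 1"
    using \<omega> \<open>0 < \<eta>\<close> \<open>0 < P\<close> by simp
  \<comment> \<open>The quotient in \<open>\<rho>\<close> is an exponential, so the rate at
    \<open>\<rho>\<close> is its exponent divided by \<open>ln 2\<close>.\<close>
  have "1 + \<omega> * \<rho> = exp (1 + lambert_W ((\<omega> * \<eta> * P - 1) / exp 1))"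
    using \<omega> lambert_quotient_eq_exp[OF y] by (simp add: rho)
  then have r_mid: "log 2 (1 + \<omega> * \<rho>) = \<rho>'"
    by (simp add: varrho log_def add.commute)
  show ?thesis
    unfolding opt plow[symmetric] using r_low r_mid \<open>plow \<le> pmax\<close>
    by (auto simp: add.commute)
qed

end
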